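(* Let $c_1,\rho\in(0,1)$ and $\vartheta>1$. Let $z_{k-1}\ne z_k$ in $\mathbb{R}^{n+1}$, $s_{k-1}=z_k-z_{k-1}$, let $b_k\in\mathbb{R}^{n+1}$ be nonzero, $g_k=\nabla\Phi_\tau(z_k)$, and let $d_k$ be the enhanced three-term direction defined in the context with some $0\le\mu_k\le\mu_k^\star$. If backtracking starts at $\alpha=1$ and repeatedly multiplies $\alpha$ by $\rho$ until the Armijo condition $\Phi_\tau(z_k+\alpha d_k)\le\Phi_\tau(z_k)+c_1\alpha\,g_k^Td_k$ holds, then the accepted step $\alpha_k$ satisfies $$\alpha_k\ge\underline\alpha:=\rho\min\left\{1,\,2(1-c_1)(1-\vartheta^{-2})\right\}>0 .$$ The lower bound $\underline\alpha$ is independent of the smoothing parameter $\tau$.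
   Context: Let $f_1,\dots,f_m\in C^1(\mathbb{R}^n)$ have gradients that are Lipschitz on $\mathbb{R}^n$ with constants $L_i\ge0$; $\bar L=\sum_i L_i$; $\tau>0$, $\delta>0$. Let $\phi_\tau(r)=\frac{r+\sqrt{r^2+\tau^2}}{2}$ and $\Phi_\tau(x,t)=t+\sum_{i=1}^m\phi_\tau(f_i(x)-t)$ on $\mathbb{R}^{n+1}$. At $z_k=(x_k,t_k)$ let $\omega_{i,k}=\sqrt{(f_i(x_k)-t_k)^2+\tau^2}$, $J_k$ the $m\times(n+1)$ matrix with rows $(\nabla f_i(x_k)^T,-1)$, $D_k=\operatorname{diag}(\omega_{1,k}^{-1},\dots,\omega_{m,k}^{-1})$, $\Pi_x=\operatorname{diag}(I_n,0)$, and $P_k=\delta I_{n+1}+\bar L\Pi_x+\frac12J_k^TD_kJ_k$, a symmetric positive definite matrix. Put $C_k=s_{k-1}^TP_ks_{k-1}$, $B_k=b_k^TP_k^{-1}b_k$, $\Delta_k=s_{k-1}^Tb_k$, $\chi_k=\Delta_k/\sqrt{C_kB_k}\in[-1,1]$, $\mathcal{D}_k=\Delta_k+\vartheta\sqrt{C_kB_k}$ (positive), $\varpi_k^2=\frac{1-\chi_k^2}{(\vartheta+\chi_k)^2}$, $\Gamma_0=\frac{\vartheta^2}{\vartheta^2-1}$, $\mu_k^\star=\frac{\Gamma_0-1-\varpi_k^2}{\sqrt{\Gamma_0}+1}$. For $\mu_k\ge0$ the enhanced direction is $$d_k=-P_k^{-1}g_k+\left[\frac{g_k^TP_k^{-1}b_k}{\mathcal{D}_k}-\mu_k\frac{g_k^Ts_{k-1}}{C_k}\right]s_{k-1}-\frac{g_k^Ts_{k-1}}{\mathcal{D}_k}P_k^{-1}b_k.$$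 *)

theory Defs
  imports "HOL-Analysis.Analysis"
begin

text \<open>
  The index type \<open>'n option\<close> has one element more than \<open>'n\<close>, so \<open>real ^ ('n option)\<close> is the
  space of points \<open>z = (x, t)\<close>: the component at \<open>Some j\<close> is the \<open>j\<close>-th component of \<open>x\<close>, and
  the component at \<open>None\<close> is \<open>t\<close>.
\<close>

definition xpart :: "real ^ ('n::finite option) \<Rightarrow> real ^ 'n" where
  "xpart z = (\<chi> j. z $ Some j)"

definition tpart :: "real ^ ('n::finite option) \<Rightarrow> real" where
  "tpart z = z $ None"

definition grad :: "('a::euclidean_space \<Rightarrow> real) \<Rightarrow> 'a \<Rightarrow> 'a" where
  "grad f x = (THE D. GDERIV f x :> D)"

lemma grad_eq:
  assumes "GDERIV f x :> D"
  shows "grad f x = D"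
  unfolding grad_def
proof (rule the_equality)
  show "GDERIV f x :> D" by (fact assms)
next
  fix E assume "GDERIV f x :> E"
  then have "(\<lambda>h. h \<bullet> E) = (\<lambda>h. h \<bullet> D)"
    using assms unfolding gderiv_def by (rule has_derivative_unique)
  then have "h \<bullet> E = h \<bullet> D" for h by (rule fun_cong)
  then show "E = D" by (metis vector_eq_ldot)
qed

lemma GDERIV_grad:
  fixes f :: "'a::euclidean_space \<Rightarrow> real"
  assumes "f differentiable (at x)"
  shows "GDERIV f x :> grad f x"
proof -
  obtain f' where f': "(f has_derivative f') (at x)"
    using assms by (auto simp: differentiable_def)
  interpret linear f' using f' by (rule has_derivative_linear)
  define D where "D = (\<Sum>b\<in>Basis. f' b *\<^sub>R b)"
  have "f' h = h \<bullet> D" for h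
  proof -
    have "f' h = f' (\<Sum>b\<in>Basis. (h \<bullet> b) *\<^sub>R b)" by (simp add: euclidean_representation)
    also have "\<dots> = (\<Sum>b\<in>Basis. (h \<bullet> b) * f' b)" by (simp add: sum scale)
    finally show ?thesis by (simp add: D_def inner_sum_right mult.commute)
  qed
  then have "GDERIV f x :> D" using f' unfolding gderiv_def by presburger
  then show ?thesis using grad_eq by metis
qed

definition phi :: "real \<Rightarrow> real \<Rightarrow> real" where
  "phi \<tau> r = (r + sqrt (r\<^sup>2 + \<tau>\<^sup>2)) / 2"

definition Phi :: "real \<Rightarrow> ('m::finite \<Rightarrow> real ^ 'n::finite \<Rightarrow> real) \<Rightarrow> real ^ ('n option) \<Rightarrow> real" where
  "Phi \<tau> f z = tpart z + (\<Sum>i\<in>UNIV. phi \<tau> (f i (xpart z) - tpart z))"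

definition omega ::
  "real \<Rightarrow> ('m::finite \<Rightarrow> real ^ 'n::finite \<Rightarrow> real) \<Rightarrow> real ^ ('n option) \<Rightarrow> 'm \<Rightarrow> real" where
  "omega \<tau> f z i = sqrt ((f i (xpart z) - tpart z)\<^sup>2 + \<tau>\<^sup>2)"

definition Jmat ::
  "('m::finite \<Rightarrow> real ^ 'n::finite \<Rightarrow> real) \<Rightarrow> real ^ ('n option) \<Rightarrow> real ^ ('n option) ^ 'm" where
  "Jmat f z = (\<chi> i j. case j of None \<Rightarrow> - 1 | Some l \<Rightarrow> grad (f i) (xpart z) $ l)"

definition Dmat ::
  "real \<Rightarrow> ('m::finite \<Rightarrow> real ^ 'n::finite \<Rightarrow> real) \<Rightarrow> real ^ ('n option) \<Rightarrow> real ^ 'm ^ 'm" where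
  "Dmat \<tau> f z = (\<chi> i j. if i = j then inverse (omega \<tau> f z i) else 0)"

definition Pi_x :: "real ^ ('n::finite option) ^ ('n option)" where
  "Pi_x = (\<chi> i j. if i = j \<and> i \<noteq> None then 1 else 0)"

definition Pmat ::
  "real \<Rightarrow> real \<Rightarrow> ('m::finite \<Rightarrow> real) \<Rightarrow> ('m \<Rightarrow> real ^ 'n::finite \<Rightarrow> real) \<Rightarrow> real ^ ('n option)
    \<Rightarrow> real ^ ('n option) ^ ('n option)" where
  "Pmat \<tau> \<delta> L f z = \<delta> *\<^sub>R mat 1 + (\<Sum>i\<in>UNIV. L i) *\<^sub>R Pi_x
     + (1/2) *\<^sub>R (transpose (Jmat f z) ** Dmat \<tau> f z ** Jmat f z)"

text \<open>
  Scalars attached to a metric \<open>P\<close>, a displacement \<open>s = s\<^bsub>k-1\<^esub>\<close> and a vector \<open>b = b\<^bsub>k\<^esub>\<close>.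
\<close>

definition Cval :: "real ^ 'p ^ 'p \<Rightarrow> real ^ 'p::finite \<Rightarrow> real" where
  "Cval P s = s \<bullet> (P *v s)"

definition Bval :: "real ^ 'p ^ 'p \<Rightarrow> real ^ 'p::finite \<Rightarrow> real" where
  "Bval P b = b \<bullet> (matrix_inv P *v b)"

definition chi :: "real ^ 'p ^ 'p \<Rightarrow> real ^ 'p \<Rightarrow> real ^ 'p::finite \<Rightarrow> real" where
  "chi P s b = (s \<bullet> b) / sqrt (Cval P s * Bval P b)"

definition Dval :: "real \<Rightarrow> real ^ 'p ^ 'p \<Rightarrow> real ^ 'p \<Rightarrow> real ^ 'p::finite \<Rightarrow> real" where
  "Dval \<theta> P s b = s \<bullet> b + \<theta> * sqrt (Cval P s * Bval P b)"

definition varpi_sq :: "real \<Rightarrow> real ^ 'p ^ 'p \<Rightarrow> real ^ 'p \<Rightarrow> real ^ 'p::finite \<Rightarrow> real" where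
  "varpi_sq \<theta> P s b = (1 - (chi P s b)\<^sup>2) / (\<theta> + chi P s b)\<^sup>2"

definition Gamma0 :: "real \<Rightarrow> real" where
  "Gamma0 \<theta> = \<theta>\<^sup>2 / (\<theta>\<^sup>2 - 1)"

definition mu_star :: "real \<Rightarrow> real ^ 'p ^ 'p \<Rightarrow> real ^ 'p \<Rightarrow> real ^ 'p::finite \<Rightarrow> real" where
  "mu_star \<theta> P s b = (Gamma0 \<theta> - 1 - varpi_sq \<theta> P s b) / (sqrt (Gamma0 \<theta>) + 1)"

definition enhanced_direction ::
  "real \<Rightarrow> real \<Rightarrow> real ^ 'p ^ 'p \<Rightarrow> real ^ 'p \<Rightarrow> real ^ 'p \<Rightarrow> real ^ 'p::finite \<Rightarrow> real ^ 'p" where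
  "enhanced_direction \<theta> \<mu> P s b g =
     - (matrix_inv P *v g)
     + ((g \<bullet> (matrix_inv P *v b)) / Dval \<theta> P s b - \<mu> * ((g \<bullet> s) / Cval P s)) *\<^sub>R s
     - ((g \<bullet> s) / Dval \<theta> P s b) *\<^sub>R (matrix_inv P *v b)"

definition armijo ::
  "('a::real_inner \<Rightarrow> real) \<Rightarrow> real \<Rightarrow> 'a \<Rightarrow> 'a \<Rightarrow> 'a \<Rightarrow> real \<Rightarrow> bool" where
  "armijo F c z g d \<alpha> \<longleftrightarrow> F (z + \<alpha> *\<^sub>R d) \<le> F z + c * \<alpha> * (g \<bullet> d)"

text \<open>
  \<open>backtracking_accepts \<rho> A \<alpha>\<close>: the trial steps \<open>1, \<rho>, \<rho>\<^sup>2, \<dots>\<close> are tested against \<open>A\<close> in this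
  order, and \<open>\<alpha>\<close> is the first one that passes.  No \<open>\<alpha>\<close> qualifies if the search never stops.
\<close>

definition backtracking_accepts :: "real \<Rightarrow> (real \<Rightarrow> bool) \<Rightarrow> real \<Rightarrow> bool" where
  "backtracking_accepts \<rho> A \<alpha> \<longleftrightarrow> (\<exists>j::nat. \<alpha> = \<rho> ^ j \<and> A (\<rho> ^ j) \<and> (\<forall>i<j. \<not> A (\<rho> ^ i)))"

end

theory Submission
  imports Defs
begin

text \<open>
  The matrix \<open>P\<close> is the curvature of a quadratic model that lies above \<open>\<Phi>\<^sub>\<tau>\<close> on the whole space:
  \<open>\<Phi>\<^sub>\<tau>(z + v) \<le> \<Phi>\<^sub>\<tau>(z) + g \<bullet> v + v \<bullet> P v / 2\<close> for every \<open>v\<close> (\<open>Phi_quadratic_majorant\<close>).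
  Along \<open>v = \<alpha> d\<close> the Armijo condition therefore holds as soon as
  \<open>\<alpha> (d \<bullet> P d) \<le> 2 (1 - c\<^sub>1) (- g \<bullet> d)\<close>.  The three-term direction satisfies
  \<open>d \<bullet> P d \<le> \<Gamma>\<^sub>0 (- g \<bullet> d)\<close> (\<open>enhanced_direction_energy_bound\<close>), and
  \<open>1 / \<Gamma>\<^sub>0 = 1 - \<theta>\<^sup>-\<^sup>2\<close>, so every \<open>\<alpha>\<close> in \<open>(0, 2 (1 - c\<^sub>1) (1 - \<theta>\<^sup>-\<^sup>2)]\<close> is accepted.  Backtracking
  by the factor \<open>\<rho>\<close> loses at most one factor \<open>\<rho>\<close> below this threshold
  (\<open>backtracking_step_bound\<close>).  The parameter \<open>\<tau>\<close> cancels because the same \<open>P\<close> measures the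
  curvature of \<open>\<Phi>\<^sub>\<tau>\<close> and the length of \<open>d\<close>.

  The energy bound is a statement about the inner product \<open>x \<bullet> P y\<close>.  Put \<open>G = P\<^sup>-\<^sup>1 g\<close>, and let
  \<open>S\<close> and \<open>W\<close> be \<open>s\<close> and \<open>P\<^sup>-\<^sup>1 b\<close> scaled to length one.  Then
  \<open>d = - G + A G - \<mu> \<langle>G, S\<rangle> S\<close> with the skew map \<open>A G = e (\<langle>G, W\<rangle> S - \<langle>G, S\<rangle> W)\<close>, where
  \<open>e = 1 / (\<theta> + \<chi>)\<close> and \<open>\<chi> = \<langle>S, W\<rangle>\<close>.  Skewness gives \<open>- g \<bullet> d = |G|\<^sup>2 + \<mu> \<langle>G, S\<rangle>\<^sup>2\<close>, and the claim becomes the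
  nonnegativity of a quadratic form in \<open>\<langle>G, S\<rangle>\<close> and the length of the component of \<open>G\<close> orthogonal
  to \<open>S\<close> (\<open>three_term_scalar_bound\<close>).
\<close>

section \<open>Backtracking line search\<close>

lemma backtracking_step_bound:
  assumes rho: "0 < \<rho>" "\<rho> < 1" and beta: "0 < \<beta>"
    and accept: "\<And>\<alpha>. 0 < \<alpha> \<Longrightarrow> \<alpha> \<le> \<beta> \<Longrightarrow> A \<alpha>"
  shows "\<exists>\<alpha>. backtracking_accepts \<rho> A \<alpha>"
    and "backtracking_accepts \<rho> A \<alpha> \<Longrightarrow> \<rho> * min 1 \<beta> \<le> \<alpha>"
proof -
  obtain n where "\<rho> ^ n < \<beta>"
    using real_arch_pow_inv[OF beta rho(2)] by blast
  then have ex: "\<exists>n. A (\<rho> ^ n)"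
    using accept[of "\<rho> ^ n"] rho(1) by (intro exI[of _ n]) (simp add: less_imp_le)
  define j where "j = (LEAST n. A (\<rho> ^ n))"
  have "A (\<rho> ^ j)" "\<forall>i<j. \<not> A (\<rho> ^ i)"
    using LeastI_ex[OF ex] not_less_Least[of _ "\<lambda>n. A (\<rho> ^ n)"] by (auto simp: j_def)
  then show "\<exists>\<alpha>. backtracking_accepts \<rho> A \<alpha>"
    unfolding backtracking_accepts_def by blast
next
  assume "backtracking_accepts \<rho> A \<alpha>"
  then obtain j where j: "\<alpha> = \<rho> ^ j" "\<forall>i<j. \<not> A (\<rho> ^ i)"
    unfolding backtracking_accepts_def by blast
  show "\<rho> * min 1 \<beta> \<le> \<alpha>"
  proof (cases j)
    case 0
    \<comment> \<open>There is no rejected trial to compare with: \<open>\<beta>\<close> may exceed 1, hence the minimum.\<close>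
    have "\<rho> * min 1 \<beta> \<le> 1 * 1" using rho beta by (intro mult_mono) auto
    with 0 j show ?thesis by simp
  next
    case (Suc i)
    \<comment> \<open>The last rejected trial lies above \<open>\<beta>\<close>, and the accepted step is \<open>\<rho>\<close> times it.\<close>
    then have "\<not> A (\<rho> ^ i)"
      using j(2) by simp
    then have "\<beta> < \<rho> ^ i"
      using accept[of "\<rho> ^ i"] rho(1) by (meson not_le zero_less_power)
    then have "\<rho> * min 1 \<beta> \<le> \<rho> * \<rho> ^ i"
      using rho(1) by (intro mult_left_mono) auto
    with Suc j show ?thesis by simp
  qed
qed

section \<open>A quadratic majorant of the smoothed objective\<close>

text \<open>
  The descent lemma.  The difference of the two sides, followed along the segment from \<open>x\<close> to
  \<open>x + h\<close>, is monotone by the Lipschitz bound on the gradient.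
\<close>

lemma lipschitz_gradient_upper_bound:
  fixes f :: "'a::euclidean_space \<Rightarrow> real"
  assumes diff: "\<And>x. f differentiable (at x)"
    and lip: "L-lipschitz_on UNIV (grad f)"
  shows "f (x + h) \<le> f x + grad f x \<bullet> h + L / 2 * (norm h)\<^sup>2"
proof -
  define \<psi> where "\<psi> = (\<lambda>t. f (x + t *\<^sub>R h) - t * (grad f x \<bullet> h) - L / 2 * (norm h)\<^sup>2 * t\<^sup>2)"
  define \<psi>' where "\<psi>' = (\<lambda>t. grad f (x + t *\<^sub>R h) \<bullet> h - grad f x \<bullet> h - L * (norm h)\<^sup>2 * t)"
  have der: "(\<psi> has_real_derivative \<psi>' t) (at t)" for t
  proof -
    have f': "(f has_derivative (\<lambda>k. k \<bullet> grad f (x + t *\<^sub>R h))) (at (x + t *\<^sub>R h))"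
      using GDERIV_grad[OF diff] unfolding gderiv_def .
    have line: "((\<lambda>t. x + t *\<^sub>R h) has_derivative (\<lambda>k. k *\<^sub>R h)) (at t)"
      by (auto intro!: derivative_eq_intros)
    have "((\<lambda>t. f (x + t *\<^sub>R h)) has_real_derivative grad f (x + t *\<^sub>R h) \<bullet> h) (at t)"
      unfolding has_field_derivative_def
      by (rule has_derivative_eq_rhs[OF has_derivative_compose[OF line f']])
        (auto simp: inner_commute)
    then show ?thesis
      unfolding \<psi>_def \<psi>'_def by (auto intro!: derivative_eq_intros)
  qed
  have neg: "\<psi>' t \<le> 0" if "0 \<le> t" for t
  proof -
    have "(grad f (x + t *\<^sub>R h) - grad f x) \<bullet> h \<le> norm (grad f (x + t *\<^sub>R h) - grad f x) * norm h"
      by (rule norm_cauchy_schwarz)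
    also have "\<dots> \<le> (L * norm (t *\<^sub>R h)) * norm h"
      using lipschitz_onD[OF lip, of "x + t *\<^sub>R h" x]
      by (intro mult_right_mono) (auto simp: dist_norm)
    also have "\<dots> = L * (norm h)\<^sup>2 * t"
      using that by (simp add: power2_eq_square)
    finally show ?thesis by (simp add: \<psi>'_def inner_diff_left)
  qed
  have "\<psi> 1 \<le> \<psi> 0"
    by (rule DERIV_nonpos_imp_nonincreasing) (use der neg in auto)
  then show ?thesis by (simp add: \<psi>_def)
qed

lemma phi_has_real_derivative:
  assumes "\<tau> > 0"
  shows "(phi \<tau> has_real_derivative (1 + r / sqrt (r\<^sup>2 + \<tau>\<^sup>2)) / 2) (at r)"
proof -
  have "r\<^sup>2 + \<tau>\<^sup>2 > 0" using assms by (simp add: add_nonneg_pos)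
  then show ?thesis
    unfolding phi_def by (auto intro!: derivative_eq_intros simp: field_simps)
qed

text \<open>
  Both \<open>\<phi>\<^sub>\<tau>\<close> and \<open>r \<mapsto> r - \<phi>\<^sub>\<tau>(r)\<close> are nondecreasing, since the slope of \<open>\<phi>\<^sub>\<tau>\<close> lies in \<open>[0, 1]\<close>.
  This lets the second-order remainder of \<open>f\<^sub>i\<close> pass through \<open>\<phi>\<^sub>\<tau>\<close> unchanged, so that it enters
  \<open>P\<close> with the plain constant \<open>L\<^sub>i\<close>.
\<close>

lemma phi_increment_le:
  assumes "\<tau> > 0" "r' \<le> r + e" "0 \<le> e"
  shows "phi \<tau> r' \<le> phi \<tau> r + e"
proof -
  have slope: "0 \<le> (1 + u / sqrt (u\<^sup>2 + \<tau>\<^sup>2)) / 2 \<and> (1 + u / sqrt (u\<^sup>2 + \<tau>\<^sup>2)) / 2 \<le> 1" for u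
  proof -
    have "\<bar>u\<bar> \<le> sqrt (u\<^sup>2 + \<tau>\<^sup>2)" by (rule real_le_rsqrt) simp
    moreover have "sqrt (u\<^sup>2 + \<tau>\<^sup>2) > 0" using assms(1) by (simp add: add_nonneg_pos)
    ultimately have "\<bar>u / sqrt (u\<^sup>2 + \<tau>\<^sup>2)\<bar> \<le> 1" by (simp add: abs_divide)
    moreover have "0 \<le> (1 + w) / 2 \<and> (1 + w) / 2 \<le> 1" if "\<bar>w\<bar> \<le> 1" for w :: real
      using that by auto
    ultimately show ?thesis by blast
  qed
  have "phi \<tau> r' \<le> phi \<tau> (r + e)"
    by (rule DERIV_nonneg_imp_nondecreasing[OF assms(2)])
      (use phi_has_real_derivative[OF assms(1)] slope in blast)
  moreover have "phi \<tau> (r + e) - (r + e) \<le> phi \<tau> r - r"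
  proof (rule DERIV_nonpos_imp_nonincreasing[where f = "\<lambda>u. phi \<tau> u - u"])
    show "\<exists>y. ((\<lambda>u. phi \<tau> u - u) has_real_derivative y) (at u) \<and> y \<le> 0" for u
      using DERIV_diff[OF phi_has_real_derivative[OF assms(1)] DERIV_ident] slope[of u]
      by (intro exI[of _ "(1 + u / sqrt (u\<^sup>2 + \<tau>\<^sup>2)) / 2 - 1"]) auto
  qed (use assms in simp)
  ultimately show ?thesis by linarith
qed

text \<open>
  With \<open>\<omega>\<close> the square root at \<open>r\<close> and \<open>\<sigma>\<close> the one at \<open>r + y\<close>, the inequality
  \<open>2 \<omega> \<sigma> \<le> \<omega>\<^sup>2 + \<sigma>\<^sup>2\<close> bounds \<open>\<sigma>\<close> by a quadratic in \<open>y\<close> that touches it at \<open>y = 0\<close>.  Its curvature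
  depends on \<open>\<omega>\<close> at the base point only, which is exactly what the weight \<open>D\<^sub>k\<close> records.
\<close>

lemma phi_quadratic_majorant:
  assumes "\<tau> > 0"
  shows "phi \<tau> (r + y) \<le> phi \<tau> r + (1 + r / sqrt (r\<^sup>2 + \<tau>\<^sup>2)) / 2 * y
           + y\<^sup>2 / (4 * sqrt (r\<^sup>2 + \<tau>\<^sup>2))"
proof -
  define \<omega> where "\<omega> = sqrt (r\<^sup>2 + \<tau>\<^sup>2)"
  define \<sigma> where "\<sigma> = sqrt ((r + y)\<^sup>2 + \<tau>\<^sup>2)"
  have \<omega>: "\<omega> > 0" "\<omega>\<^sup>2 = r\<^sup>2 + \<tau>\<^sup>2"
    using assms by (auto simp: \<omega>_def add_nonneg_pos)
  have \<sigma>: "\<sigma>\<^sup>2 = (r + y)\<^sup>2 + \<tau>\<^sup>2" by (simp add: \<sigma>_def)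
  have "0 \<le> (\<sigma> - \<omega>)\<^sup>2" by simp
  then have "2 * \<omega> * \<sigma> \<le> 2 * \<omega>\<^sup>2 + 2 * r * y + y\<^sup>2"
    using \<omega>(2) \<sigma> by (simp add: power2_eq_square algebra_simps)
  then have "\<sigma> \<le> (2 * \<omega>\<^sup>2 + 2 * r * y + y\<^sup>2) / (2 * \<omega>)"
    using \<omega>(1) by (simp add: pos_le_divide_eq mult.commute)
  also have "\<dots> = \<omega> + r / \<omega> * y + y\<^sup>2 / (2 * \<omega>)"
    using \<omega>(1) by (simp add: field_simps power2_eq_square)
  finally have "phi \<tau> (r + y) \<le> (r + y + (\<omega> + r / \<omega> * y + y\<^sup>2 / (2 * \<omega>))) / 2"
    unfolding phi_def \<sigma>_def[symmetric] by (intro divide_right_mono add_left_mono) auto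
  also have "\<dots> = phi \<tau> r + (1 + r / \<omega>) / 2 * y + y\<^sup>2 / (4 * \<omega>)"
    unfolding phi_def \<omega>_def[symmetric] using \<omega>(1) by (simp add: field_simps)
  finally show ?thesis by (simp add: \<omega>_def)
qed

lemma bounded_linear_xpart: "bounded_linear (xpart :: real ^ ('n::finite option) \<Rightarrow> real ^ 'n)"
  by (rule linear_conv_bounded_linear[THEN iffD1], rule linearI)
    (simp_all add: xpart_def vec_eq_iff)

lemma bounded_linear_tpart: "bounded_linear (tpart :: real ^ ('n::finite option) \<Rightarrow> real)"
  by (rule linear_conv_bounded_linear[THEN iffD1], rule linearI)
    (simp_all add: tpart_def)

lemma Jmat_mult:
  "(Jmat f z *v v) $ i = grad (f i) (xpart z) \<bullet> xpart v - tpart v"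
  by (simp add: matrix_vector_mult_def Jmat_def UNIV_option_conv sum.reindex inner_vec_def
      xpart_def tpart_def)

lemma Pi_x_mult_quadratic: "v \<bullet> (Pi_x *v v) = (norm (xpart v))\<^sup>2"
proof -
  have "(Pi_x *v v) $ i = (if i = None then 0 else v $ i)" for i
    by (cases i) (simp_all add: matrix_vector_mult_def Pi_x_def mult_delta_left)
  then show ?thesis
    by (simp add: inner_vec_def UNIV_option_conv sum.reindex xpart_def power2_norm_eq_inner)
qed

lemma Dmat_mult: "(Dmat \<tau> f z *v y) $ i = y $ i / omega \<tau> f z i"
  by (simp add: matrix_vector_mult_def Dmat_def mult_delta_left divide_inverse)

lemma Pmat_quadratic:
  "v \<bullet> (Pmat \<tau> \<delta> L f z *v v) =
     \<delta> * (norm v)\<^sup>2 + (\<Sum>i\<in>UNIV. L i) * (norm (xpart v))\<^sup>2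
     + (\<Sum>i\<in>UNIV. (grad (f i) (xpart z) \<bullet> xpart v - tpart v)\<^sup>2 / (2 * omega \<tau> f z i))"
proof -
  let ?J = "Jmat f z" and ?D = "Dmat \<tau> f z"
  have "v \<bullet> ((transpose ?J ** ?D ** ?J) *v v) = (?J *v v) \<bullet> (?D *v (?J *v v))"
    by (metis matrix_vector_mul_assoc dot_lmul_matrix transpose_matrix_vector inner_commute)
  also have "\<dots> = (\<Sum>i\<in>UNIV. (grad (f i) (xpart z) \<bullet> xpart v - tpart v)\<^sup>2 / omega \<tau> f z i)"
    by (simp add: inner_vec_def[of "?J *v v"] Dmat_mult Jmat_mult power2_eq_square)
  finally have *: "v \<bullet> ((transpose ?J ** ?D ** ?J) *v v)
      = (\<Sum>i\<in>UNIV. (grad (f i) (xpart z) \<bullet> xpart v - tpart v)\<^sup>2 / omega \<tau> f z i)" .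
  show ?thesis
    unfolding Pmat_def
    by (simp add: matrix_vector_mult_add_rdistrib scaleR_matrix_vector_assoc[symmetric]
        inner_add_right Pi_x_mult_quadratic * power2_norm_eq_inner sum_divide_distrib mult.commute)
qed

lemma Pmat_symmetric:
  fixes z :: "real ^ ('n::finite option)"
  shows "transpose (Pmat \<tau> \<delta> L f z) = Pmat \<tau> \<delta> L f z"
proof -
  have sym: "transpose (Dmat \<tau> f z) = Dmat \<tau> f z" "transpose (Pi_x :: real ^ ('n option) ^ ('n option)) = Pi_x"
    by (auto simp: transpose_def Dmat_def Pi_x_def vec_eq_iff)
  have "transpose (transpose (Jmat f z) ** Dmat \<tau> f z ** Jmat f z)
      = transpose (Jmat f z) ** Dmat \<tau> f z ** Jmat f z"
    by (simp add: matrix_transpose_mul sym matrix_mul_assoc)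
  moreover have "transpose (A + B) = transpose A + transpose B" "transpose (c *\<^sub>R A) = c *\<^sub>R transpose A"
    for A B :: "real ^ ('n option) ^ ('n option)" and c
    by (simp_all add: transpose_def vec_eq_iff)
  ultimately show ?thesis by (simp add: Pmat_def sym)
qed

lemma omega_pos: "\<tau> > 0 \<Longrightarrow> omega \<tau> f z i > 0"
  by (simp add: omega_def add_nonneg_pos)

lemma Pmat_pos_def:
  assumes "\<tau> > 0" "\<delta> > 0" "\<And>i. 0 \<le> L i" "v \<noteq> 0"
  shows "0 < v \<bullet> (Pmat \<tau> \<delta> L f z *v v)"
proof -
  have "0 < \<delta> * (norm v)\<^sup>2" using assms by simp
  moreover have "0 \<le> (\<Sum>i\<in>UNIV. L i) * (norm (xpart v))\<^sup>2"
    using assms(3) by (intro mult_nonneg_nonneg sum_nonneg) auto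
  moreover have "0 \<le> (\<Sum>i\<in>UNIV. (grad (f i) (xpart z) \<bullet> xpart v - tpart v)\<^sup>2 / (2 * omega \<tau> f z i))"
    using omega_pos[OF assms(1)] by (intro sum_nonneg divide_nonneg_pos) auto
  ultimately show ?thesis by (simp add: Pmat_quadratic)
qed

lemma grad_Phi_inner:
  assumes diff: "\<And>i x. f i differentiable (at x)" and "\<tau> > 0"
  shows "grad (Phi \<tau> f) z \<bullet> v = tpart v
    + (\<Sum>i\<in>UNIV. (1 + (f i (xpart z) - tpart z) / omega \<tau> f z i) / 2
                  * (grad (f i) (xpart z) \<bullet> xpart v - tpart v))"
    (is "_ = ?d v")
proof -
  have x: "(xpart has_derivative xpart) (at z)" and t: "(tpart has_derivative tpart) (at z)"
    by (rule bounded_linear_imp_has_derivative, rule bounded_linear_xpart bounded_linear_tpart)+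
  have f: "((\<lambda>z. f i (xpart z)) has_derivative (\<lambda>v. grad (f i) (xpart z) \<bullet> xpart v)) (at z)" for i
    using has_derivative_compose[OF x GDERIV_grad[OF diff, unfolded gderiv_def]]
    by (simp add: inner_commute)
  have "((\<lambda>z. phi \<tau> (f i (xpart z) - tpart z)) has_derivative
      (\<lambda>v. (1 + (f i (xpart z) - tpart z) / omega \<tau> f z i) / 2
           * (grad (f i) (xpart z) \<bullet> xpart v - tpart v))) (at z)" for i
    using has_derivative_compose[OF has_derivative_diff[OF f t]
        phi_has_real_derivative[OF assms(2), unfolded has_field_derivative_def]]
    by (simp add: omega_def)
  then have D: "(Phi \<tau> f has_derivative ?d) (at z)"
    unfolding Phi_def[abs_def] by (intro has_derivative_add t has_derivative_sum)
  then have "GDERIV (Phi \<tau> f) z :> grad (Phi \<tau> f) z"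
    by (intro GDERIV_grad) (auto simp: differentiable_def)
  then have "(\<lambda>v. v \<bullet> grad (Phi \<tau> f) z) = ?d"
    using D unfolding gderiv_def by (rule has_derivative_unique)
  then show ?thesis by (metis inner_commute)
qed

text \<open>
  The argument of \<open>\<phi>\<^sub>\<tau>\<close> at \<open>z + v\<close> is at most \<open>r\<^sub>i + (J v)\<^sub>i + L\<^sub>i |x(v)|\<^sup>2 / 2\<close>, where \<open>x(v)\<close> denotes the
  first \<open>n\<close> components of \<open>v\<close>.  The last term is moved out by \<open>phi_increment_le\<close>; the linear
  increment \<open>(J v)\<^sub>i\<close> that remains is treated by \<open>phi_quadratic_majorant\<close>.
\<close>

lemma Phi_quadratic_majorant:
  assumes diff: "\<And>i x. f i differentiable (at x)"
    and lip: "\<And>i. (L i)-lipschitz_on UNIV (grad (f i))"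
    and "\<tau> > 0" "\<delta> \<ge> 0"
  shows "Phi \<tau> f (z + v) \<le> Phi \<tau> f z + grad (Phi \<tau> f) z \<bullet> v + (v \<bullet> (Pmat \<tau> \<delta> L f z *v v)) / 2"
proof -
  define r where "r i = f i (xpart z) - tpart z" for i
  define y where "y i = grad (f i) (xpart z) \<bullet> xpart v - tpart v" for i
  define \<omega> where "\<omega> i = omega \<tau> f z i" for i
  have \<omega>: "\<omega> i = sqrt ((r i)\<^sup>2 + \<tau>\<^sup>2)" for i by (simp add: \<omega>_def omega_def r_def)
  have add: "xpart (z + v) = xpart z + xpart v" "tpart (z + v) = tpart z + tpart v"
    by (simp_all add: xpart_def tpart_def vec_eq_iff)
  have each: "phi \<tau> (f i (xpart (z + v)) - tpart (z + v))
      \<le> phi \<tau> (r i) + (1 + r i / \<omega> i) / 2 * y i + (y i)\<^sup>2 / (4 * \<omega> i) + L i * (norm (xpart v))\<^sup>2 / 2" for i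
  proof -
    have "phi \<tau> (f i (xpart (z + v)) - tpart (z + v)) \<le> phi \<tau> (r i + y i) + L i / 2 * (norm (xpart v))\<^sup>2"
      using lipschitz_gradient_upper_bound[OF diff lip, of i "xpart z" "xpart v"] lipschitz_on_nonneg[OF lip, of i]
      by (intro phi_increment_le[OF assms(3)]) (auto simp: add r_def y_def)
    with phi_quadratic_majorant[OF assms(3), of "r i" "y i"] show ?thesis by (simp add: \<omega>)
  qed
  have "Phi \<tau> f (z + v) \<le> tpart z + tpart v + (\<Sum>i\<in>UNIV. phi \<tau> (r i) + (1 + r i / \<omega> i) / 2 * y i
      + (y i)\<^sup>2 / (4 * \<omega> i) + L i * (norm (xpart v))\<^sup>2 / 2)"
    unfolding Phi_def using each by (auto simp: add(2) intro!: sum_mono)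
  also have "\<dots> = Phi \<tau> f z + grad (Phi \<tau> f) z \<bullet> v
      + ((\<Sum>i\<in>UNIV. L i) * (norm (xpart v))\<^sup>2 + (\<Sum>i\<in>UNIV. (y i)\<^sup>2 / (2 * \<omega> i))) / 2"
    unfolding grad_Phi_inner[OF diff assms(3)]
    by (simp add: Phi_def sum.distrib sum_divide_distrib sum_distrib_right add_divide_distrib
        r_def[symmetric] y_def[symmetric] \<omega>_def[symmetric])
  also have "\<dots> \<le> Phi \<tau> f z + grad (Phi \<tau> f) z \<bullet> v + (v \<bullet> (Pmat \<tau> \<delta> L f z *v v)) / 2"
    using assms(4) by (simp add: Pmat_quadratic y_def \<omega>_def)
  finally show ?thesis .
qed

section \<open>The energy of the three-term direction\<close>

lemma psd_form_Cauchy_Schwarz: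
  fixes P :: "real ^ 'p ^ 'p::finite"
  assumes sym: "transpose P = P" and psd: "\<And>v. 0 \<le> v \<bullet> (P *v v)"
  shows "(x \<bullet> (P *v y))\<^sup>2 \<le> (x \<bullet> (P *v x)) * (y \<bullet> (P *v y))"
proof -
  have comm: "y \<bullet> (P *v x) = x \<bullet> (P *v y)"
    by (metis sym dot_lmul_matrix transpose_matrix_vector inner_commute)
  let ?X = "x \<bullet> (P *v x)" and ?Y = "y \<bullet> (P *v y)" and ?B = "x \<bullet> (P *v y)"
  have quad: "0 \<le> a\<^sup>2 * ?X + 2 * a * c * ?B + c\<^sup>2 * ?Y" for a c
  proof -
    have "(a *\<^sub>R x + c *\<^sub>R y) \<bullet> (P *v (a *\<^sub>R x + c *\<^sub>R y)) = a\<^sup>2 * ?X + 2 * a * c * ?B + c\<^sup>2 * ?Y"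
      by (simp add: matrix_vector_right_distrib matrix_vector_mult_scaleR inner_add_left inner_add_right
          comm power2_eq_square algebra_simps)
    then show ?thesis using psd by metis
  qed
  have discr: "\<And>a. 0 \<le> ?X * a\<^sup>2 + 2 * ?B * a + ?Y"
    using quad[of _ 1] by (simp add: algebra_simps)
  show ?thesis
  proof (cases "?X = 0")
    case True
    have "?B = 0"
    proof (rule ccontr)
      assume "?B \<noteq> 0"
      \<comment> \<open>The quadratic degenerates to an affine function, which takes the value \<open>-1\<close> here.\<close>
      then show False using discr[of "- (?Y + 1) / (2 * ?B)"] True by (simp add: field_simps)
    qed
    then show ?thesis using True by simp
  next
    case False
    then have "?X > 0" using psd[of x] by simp
    \<comment> \<open>The coefficients make \<open>a x + c y\<close> a multiple of the part of \<open>y\<close> orthogonal to \<open>x\<close>.\<close>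
    have "0 \<le> ?X * (?X * ?Y - ?B\<^sup>2)"
      using quad[of "- ?B" ?X] by (simp add: power2_eq_square algebra_simps)
    then show ?thesis using \<open>?X > 0\<close> by (simp add: zero_le_mult_iff)
  qed
qed

text \<open>
  In the notation of the introductory remark \<open>N = |G|\<^sup>2\<close>, \<open>p = \<langle>G, S\<rangle>\<close>, \<open>q = \<langle>G, W\<rangle>\<close> and
  \<open>\<eta> = \<langle>S, W\<rangle>\<close>; the left-hand side of the conclusion is the squared length of \<open>- G + x S - y W\<close>.
  The assumption \<open>gram\<close> is Cauchy-Schwarz for the parts of \<open>G\<close> and \<open>W\<close> orthogonal to \<open>S\<close>.

  Let \<open>m\<^sup>2 = N - p\<^sup>2\<close>, \<open>k = e\<^sup>2 (1 - \<eta>\<^sup>2)\<close> and \<open>a = \<Gamma> - 1 - k\<close>.  The difference of the two sides is at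
  least the binary form in \<open>m\<close> and \<open>|p|\<close> with diagonal entries \<open>a\<close> and
  \<open>a + (a + k - 1) \<mu> - \<mu>\<^sup>2\<close> and off-diagonal entry \<open>- \<mu> \<surd>k\<close>.  Its determinant factors as
  \<open>(a + (a + k) \<mu>) (a - \<mu>)\<close>, which is nonnegative for \<open>0 \<le> \<mu> \<le> a\<close>.
\<close>

lemma three_term_scalar_bound:
  fixes N p q \<eta> e \<mu> \<Gamma> :: real
  assumes Np: "p\<^sup>2 \<le> N" and chi: "\<eta>\<^sup>2 \<le> 1"
    and gram: "(q - p * \<eta>)\<^sup>2 \<le> (1 - \<eta>\<^sup>2) * (N - p\<^sup>2)"
    and mu: "0 \<le> \<mu>" "\<mu> \<le> \<Gamma> - 1 - e\<^sup>2 * (1 - \<eta>\<^sup>2)"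
  defines "x \<equiv> e * q - \<mu> * p" and "y \<equiv> e * p"
  shows "N + x\<^sup>2 + y\<^sup>2 - 2 * x * p + 2 * y * q - 2 * x * y * \<eta> \<le> \<Gamma> * (N + \<mu> * p\<^sup>2)"
proof -
  define k where "k = e\<^sup>2 * (1 - \<eta>\<^sup>2)"
  define a where "a = \<Gamma> - 1 - k"
  define X where "X = e * (q - p * \<eta>)"
  define m where "m = sqrt (N - p\<^sup>2)"
  define l where "l = sqrt k"
  have k0: "0 \<le> k" using chi by (simp add: k_def)
  have a: "0 \<le> \<mu>" "\<mu> \<le> a" using mu by (auto simp: a_def k_def)
  have m: "0 \<le> m" "m\<^sup>2 = N - p\<^sup>2" and l: "0 \<le> l" "l\<^sup>2 = k"
    using Np k0 by (auto simp: m_def l_def)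
  \<comment> \<open>\<open>X\<close> is the inner product of \<open>S\<close> with the skew part \<open>e (q S - p W)\<close> of the direction.\<close>
  have "X\<^sup>2 = e\<^sup>2 * (q - p * \<eta>)\<^sup>2" by (simp add: X_def power_mult_distrib)
  also have "\<dots> \<le> e\<^sup>2 * ((1 - \<eta>\<^sup>2) * (N - p\<^sup>2))" using gram by (rule mult_left_mono) simp
  also have "\<dots> = (l * m)\<^sup>2" by (simp add: power_mult_distrib l m k_def)
  finally have X2: "X\<^sup>2 \<le> (l * m)\<^sup>2" .
  have absX: "\<bar>X\<bar> \<le> l * m"
    using X2 l(1) m(1) by (metis abs_le_square_iff abs_of_nonneg mult_nonneg_nonneg)
  have "\<bar>p * X\<bar> \<le> \<bar>p\<bar> * (l * m)"
    using absX by (simp add: abs_mult mult_left_mono)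
  then have "\<mu> * \<bar>p * X\<bar> \<le> \<mu> * (\<bar>p\<bar> * (l * m))"
    using a(1) by (rule mult_left_mono)
  moreover have "\<mu> * - \<bar>p * X\<bar> \<le> \<mu> * (p * X)"
    using a(1) by (intro mult_left_mono) auto
  ultimately have cross: "- (\<mu> * (\<bar>p\<bar> * (l * m))) \<le> \<mu> * (p * X)" by simp
  define Q where "Q = a * m\<^sup>2 - 2 * (\<mu> * (\<bar>p\<bar> * (l * m))) + (a + (a + k - 1) * \<mu> - \<mu>\<^sup>2) * p\<^sup>2"
  have Q: "0 \<le> Q"
  proof (cases "a = 0")
    case True
    then have "\<mu> = 0" using a by simp
    then show ?thesis using True by (simp add: Q_def)
  next
    case False
    then have "a > 0" using a by simp
    \<comment> \<open>Completing the square; the coefficient of \<open>p\<^sup>2\<close> is the determinant.\<close>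
    have "a * Q = (a * m - \<mu> * l * \<bar>p\<bar>)\<^sup>2 + (a + (a + k) * \<mu>) * (a - \<mu>) * p\<^sup>2"
      unfolding Q_def power2_abs[of p, symmetric] l(2)[symmetric]
      by (simp add: power2_eq_square algebra_simps)
    also have "\<dots> \<ge> 0" using a k0 by (intro add_nonneg_nonneg mult_nonneg_nonneg) auto
    finally show ?thesis using \<open>a > 0\<close> by (simp add: zero_le_mult_iff)
  qed
  have "\<Gamma> * (N + \<mu> * p\<^sup>2) - (N + x\<^sup>2 + y\<^sup>2 - 2 * x * p + 2 * y * q - 2 * x * y * \<eta>)
      = a * m\<^sup>2 + (k * m\<^sup>2 - X\<^sup>2) + 2 * (\<mu> * (p * X)) + (a + (a + k - 1) * \<mu> - \<mu>\<^sup>2) * p\<^sup>2"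
    unfolding m(2) a_def k_def X_def x_def y_def by (simp add: power2_eq_square algebra_simps)
  also have "\<dots> \<ge> Q" using cross X2 by (simp add: Q_def power_mult_distrib l(2))
  finally show ?thesis using Q by linarith
qed

lemma pos_def_matrix_inv:
  fixes P :: "real ^ 'p ^ 'p::finite"
  assumes pd: "\<And>v. v \<noteq> 0 \<Longrightarrow> 0 < v \<bullet> (P *v v)"
  shows "P *v (matrix_inv P *v v) = v"
proof -
  have "inj ((*v) P)"
    using pd by (intro linear_injective_0[THEN iffD2]) force+
  then have "invertible P"
    by (simp add: invertible_left_inverse matrix_left_invertible_injective)
  then show ?thesis
    using someI_ex[of "\<lambda>A. P ** A = mat 1 \<and> A ** P = mat 1"]
    by (simp add: invertible_def matrix_inv_def matrix_vector_mul_assoc)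
qed

text \<open>
  Passing to \<open>G\<close>, \<open>S\<close> and \<open>W\<close> leaves only the Gram scalars of these three vectors.  The cap on
  \<open>\<mu>\<close> enters because \<open>\<mu>\<^sup>\<star> (\<surd>\<Gamma>\<^sub>0 + 1)\<close> is the number \<open>a\<close> of \<open>three_term_scalar_bound\<close>.
\<close>

lemma enhanced_direction_energy_bound:
  fixes P :: "real ^ 'p ^ 'p::finite" and s b g :: "real ^ 'p"
  assumes sym: "transpose P = P" and pd: "\<And>v. v \<noteq> 0 \<Longrightarrow> 0 < v \<bullet> (P *v v)"
    and s: "s \<noteq> 0" and b: "b \<noteq> 0" and theta: "\<theta> > 1"
    and mu: "0 \<le> \<mu>" "\<mu> \<le> mu_star \<theta> P s b"
  defines "d \<equiv> enhanced_direction \<theta> \<mu> P s b g"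
  shows "d \<bullet> (P *v d) \<le> Gamma0 \<theta> * - (g \<bullet> d)"
proof -
  define G w where "G = matrix_inv P *v g" and "w = matrix_inv P *v b"
  have PG: "P *v G = g" and Pw: "P *v w = b"
    using pos_def_matrix_inv[OF pd] by (auto simp: G_def w_def)
  have psd: "0 \<le> v \<bullet> (P *v v)" for v using pd[of v] by (cases "v = 0") auto
  have comm: "x \<bullet> (P *v y) = y \<bullet> (P *v x)" for x y
    by (metis sym dot_lmul_matrix transpose_matrix_vector inner_commute)
  define C B where "C = Cval P s" and "B = Bval P b"
  have C: "C > 0" using pd[OF s] by (simp add: C_def Cval_def)
  have "w \<noteq> 0" using Pw b by auto
  then have B: "B > 0" using pd[of w] by (simp add: B_def Bval_def Pw inner_commute flip: w_def)
  define S W where "S = (1 / sqrt C) *\<^sub>R s" and "W = (1 / sqrt B) *\<^sub>R w"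
  have s_S: "s = sqrt C *\<^sub>R S" and w_W: "w = sqrt B *\<^sub>R W" using C B by (auto simp: S_def W_def)
  define N p q \<eta> where "N = G \<bullet> (P *v G)" and "p = G \<bullet> (P *v S)" and "q = G \<bullet> (P *v W)"
    and "\<eta> = S \<bullet> (P *v W)"
  have SS: "S \<bullet> (P *v S) = 1"
    using C by (simp add: S_def matrix_vector_mult_scaleR C_def[unfolded Cval_def, symmetric])
  have WW: "W \<bullet> (P *v W) = 1"
    using B by (simp add: W_def matrix_vector_mult_scaleR Pw inner_commute
        B_def[unfolded Bval_def, folded w_def, symmetric])
  have chi: "chi P s b = \<eta>"
    using C B unfolding chi_def \<eta>_def S_def W_def
    by (simp add: matrix_vector_mult_scaleR Pw real_sqrt_mult flip: C_def B_def)
  have gs: "g \<bullet> s = sqrt C * p"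
    by (metis PG comm inner_commute inner_scaleR_right matrix_vector_mult_scaleR p_def s_S)
  have gw: "g \<bullet> w = sqrt B * q"
    by (metis PG comm inner_commute inner_scaleR_right matrix_vector_mult_scaleR q_def w_W)
  have expand: "(i *\<^sub>R G + j *\<^sub>R S + k *\<^sub>R W) \<bullet> (P *v (i' *\<^sub>R G + j' *\<^sub>R S + k' *\<^sub>R W))
     = i * i' * N + j * j' + k * k' + (i * j' + j * i') * p + (i * k' + k * i') * q + (j * k' + k * j') * \<eta>"
    for i j k i' j' k'
    by (simp add: matrix_vector_right_distrib matrix_vector_mult_scaleR inner_add_left inner_add_right
        SS WW comm[of S G] comm[of W G] comm[of W S] N_def[symmetric] p_def[symmetric] q_def[symmetric]
        \<eta>_def[symmetric] algebra_simps)
  have chi2: "\<eta>\<^sup>2 \<le> 1" and pN: "p\<^sup>2 \<le> N"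
    using psd_form_Cauchy_Schwarz[OF sym psd, of S W] psd_form_Cauchy_Schwarz[OF sym psd, of G S]
    by (simp_all add: SS WW \<eta>_def p_def N_def)
  \<comment> \<open>Cauchy-Schwarz for \<open>W - \<eta> S\<close> and \<open>G - p S\<close>, both orthogonal to \<open>S\<close>.\<close>
  have gram: "(q - p * \<eta>)\<^sup>2 \<le> (1 - \<eta>\<^sup>2) * (N - p\<^sup>2)"
    using psd_form_Cauchy_Schwarz[OF sym psd, of "0 *\<^sub>R G + (-\<eta>) *\<^sub>R S + 1 *\<^sub>R W" "1 *\<^sub>R G + (-p) *\<^sub>R S + 0 *\<^sub>R W"]
    unfolding expand by (simp add: power2_eq_square algebra_simps)
  have pos: "\<theta> + \<eta> > 0" using chi2 theta by (simp add: abs_square_le_1)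
  define e where "e = 1 / (\<theta> + \<eta>)"
  have e: "e > 0" using pos by (simp add: e_def)
  have "Dval \<theta> P s b = sqrt C * sqrt B * (\<theta> + \<eta>)"
  proof -
    have "s \<bullet> b = chi P s b * sqrt (C * B)"
      using C B by (simp add: chi_def C_def B_def)
    then show ?thesis by (simp add: Dval_def chi real_sqrt_mult algebra_simps flip: C_def B_def)
  qed
  then have D: "Dval \<theta> P s b = sqrt C * sqrt B / e" by (simp add: e_def)
  define x y where "x = e * q - \<mu> * p" and "y = e * p"
  have d: "d = (-1) *\<^sub>R G + x *\<^sub>R S + (-y) *\<^sub>R W"
  proof -
    have "(g \<bullet> w / Dval \<theta> P s b - \<mu> * (g \<bullet> s / C)) * sqrt C = x"
    proof -
      have "(\<beta> * q / (c * \<beta> / e) - \<mu> * (c * p / c\<^sup>2)) * c = x" if "c > 0" "\<beta> > 0" for c \<beta>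
        using that e by (simp add: x_def field_simps power2_eq_square)
      from this[of "sqrt C" "sqrt B"] show ?thesis using C B by (simp add: gs gw D)
    qed
    moreover have "(g \<bullet> s / Dval \<theta> P s b) * sqrt B = y"
      using C B e by (simp add: gs D y_def field_simps)
    ultimately show ?thesis
      unfolding d_def enhanced_direction_def G_def[symmetric] w_def[symmetric] C_def[symmetric]
      by (subst (3) s_S, subst (2) w_W) simp
  qed
  have dPd: "d \<bullet> (P *v d) = N + x\<^sup>2 + y\<^sup>2 - 2 * x * p + 2 * y * q - 2 * x * y * \<eta>"
    unfolding d expand by (simp add: power2_eq_square algebra_simps)
  have "g \<bullet> d = d \<bullet> (P *v (1 *\<^sub>R G + 0 *\<^sub>R S + 0 *\<^sub>R W))" by (simp add: PG inner_commute)
  then have gd: "- (g \<bullet> d) = N + \<mu> * p\<^sup>2"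
    unfolding d expand by (simp add: x_def y_def power2_eq_square algebra_simps)
  have "\<mu> \<le> Gamma0 \<theta> - 1 - e\<^sup>2 * (1 - \<eta>\<^sup>2)"
  proof -
    have "Gamma0 \<theta> \<ge> 0" using theta by (simp add: Gamma0_def)
    then have "\<mu> * (sqrt (Gamma0 \<theta>) + 1) \<le> Gamma0 \<theta> - 1 - varpi_sq \<theta> P s b"
      using mu(2) by (simp add: mu_star_def pos_le_divide_eq add_nonneg_pos)
    moreover have "\<mu> \<le> \<mu> * (sqrt (Gamma0 \<theta>) + 1)"
      using mu(1) \<open>Gamma0 \<theta> \<ge> 0\<close> by (simp add: algebra_simps)
    ultimately show ?thesis by (simp add: varpi_sq_def chi e_def power_divide)
  qed
  then show ?thesis
    unfolding dPd gd x_def y_def by (intro three_term_scalar_bound pN chi2 gram mu)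
qed

theorem corollary6p2:
  fixes f :: "'m::finite \<Rightarrow> real ^ 'n::finite \<Rightarrow> real"
    and L :: "'m \<Rightarrow> real"
    and \<tau> \<delta> c\<^sub>1 \<rho> \<theta> \<mu> :: real
    and z_prev z s b g d :: "real ^ ('n option)"
    and P :: "real ^ ('n option) ^ ('n option)"
  assumes f_diff: "\<And>i x. f i differentiable (at x)"
    and f_C1: "\<And>i. continuous_on UNIV (grad (f i))"
    and f_lip: "\<And>i. (L i)-lipschitz_on UNIV (grad (f i))"
    and tau: "\<tau> > 0" and delta: "\<delta> > 0"
    and c1: "0 < c\<^sub>1" "c\<^sub>1 < 1"
    and rho: "0 < \<rho>" "\<rho> < 1"
    and theta: "\<theta> > 1"
    and z_neq: "z_prev \<noteq> z"
    and s_eq: "s = z - z_prev"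
    and b_nz: "b \<noteq> 0"
    and g_eq: "g = grad (Phi \<tau> f) z"
    and P_eq: "P = Pmat \<tau> \<delta> L f z"
    and mu: "0 \<le> \<mu>" "\<mu> \<le> mu_star \<theta> P s b"
    and d_eq: "d = enhanced_direction \<theta> \<mu> P s b g"
  shows "(\<exists>\<alpha>. backtracking_accepts \<rho> (armijo (Phi \<tau> f) c\<^sub>1 z g d) \<alpha>)
    \<and> (\<forall>\<alpha>. backtracking_accepts \<rho> (armijo (Phi \<tau> f) c\<^sub>1 z g d) \<alpha>
          \<longrightarrow> \<alpha> \<ge> \<rho> * min 1 (2 * (1 - c\<^sub>1) * (1 - 1 / \<theta>\<^sup>2)))
    \<and> \<rho> * min 1 (2 * (1 - c\<^sub>1) * (1 - 1 / \<theta>\<^sup>2)) > 0"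
proof -
  define \<kappa> where "\<kappa> = 1 - 1 / \<theta>\<^sup>2"
  have theta2: "\<theta>\<^sup>2 > 1" using theta by (simp add: one_less_power)
  then have kappa: "\<kappa> > 0" "\<kappa> * Gamma0 \<theta> = 1"
    using theta by (auto simp: \<kappa>_def Gamma0_def field_simps)
  define \<beta> where "\<beta> = 2 * (1 - c\<^sub>1) * \<kappa>"
  have beta: "\<beta> > 0" using kappa c1 by (simp add: \<beta>_def)
  have L: "0 \<le> L i" for i using f_lip by (rule lipschitz_on_nonneg)
  have "d \<bullet> (P *v d) \<le> Gamma0 \<theta> * - (g \<bullet> d)"
    unfolding d_eq P_eq using mu z_neq
    by (intro enhanced_direction_energy_bound Pmat_symmetric Pmat_pos_def tau delta L b_nz theta)
      (auto simp: P_eq s_eq)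
  then have energy: "\<kappa> * (d \<bullet> (P *v d)) \<le> - (g \<bullet> d)"
    using mult_left_mono[of _ _ \<kappa>] kappa by (metis less_imp_le mult.assoc mult_1)
  have nonneg: "0 \<le> d \<bullet> (P *v d)"
    unfolding P_eq by (cases "d = 0") (auto intro!: less_imp_le Pmat_pos_def tau delta L)
  have accept: "armijo (Phi \<tau> f) c\<^sub>1 z g d \<alpha>" if "0 < \<alpha>" "\<alpha> \<le> \<beta>" for \<alpha>
  proof -
    have "\<alpha> * (d \<bullet> (P *v d)) \<le> \<beta> * (d \<bullet> (P *v d))"
      using that(2) nonneg by (rule mult_right_mono)
    also have "\<dots> = 2 * (1 - c\<^sub>1) * (\<kappa> * (d \<bullet> (P *v d)))" by (simp add: \<beta>_def)
    also have "\<dots> \<le> 2 * (1 - c\<^sub>1) * - (g \<bullet> d)"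
      using energy c1 by (intro mult_left_mono) auto
    finally have "\<alpha> * (\<alpha> * (d \<bullet> (P *v d))) \<le> \<alpha> * (2 * (1 - c\<^sub>1) * - (g \<bullet> d))"
      using that(1) by (intro mult_left_mono) auto
    moreover have "Phi \<tau> f (z + \<alpha> *\<^sub>R d) \<le> Phi \<tau> f z + \<alpha> * (g \<bullet> d) + \<alpha> * (\<alpha> * (d \<bullet> (P *v d))) / 2"
      using Phi_quadratic_majorant[of f L, OF f_diff f_lip tau less_imp_le[OF delta], of z "\<alpha> *\<^sub>R d"]
      by (simp add: g_eq P_eq matrix_vector_mult_scaleR)
    ultimately show ?thesis by (simp add: armijo_def algebra_simps)
  qed
  show ?thesis
    using backtracking_step_bound[where A = "armijo (Phi \<tau> f) c\<^sub>1 z g d", OF rho beta accept] rho(1) beta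
    unfolding \<beta>_def \<kappa>_def by simp
qed

end
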